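(* Let $k\ge 6$. Then $\sup_{n\in\mathbb{N}}|F_k(n)-\alpha_k n|=+\infty$, and in fact $\sup_{n}\delta_k(n)=+\infty$ and $\inf_n\delta_k(n)=-\infty$. More precisely, let $r$ be a complex zero of $Q_k(X)=X^k-X^{k-1}-1$ of maximal modulus among the zeros of $Q_k$ different from $\beta_k$, and let $a=\ln|r|/\ln\beta_k$; then $0<a<1$, and there exist a constant $C>0$ and two strictly increasing sequences of natural numbers $(v_n)$, $(v'_n)$ such that, setting $u_n=A_{k,v_n}$ and $u'_n=A_{k,v'_n}$, for all $n\ge 0$: \[\delta_k(u_n)>C\,u_n^{\,a}\qquad\text{and}\qquad \delta_k(u'_n)<-C\,(u'_n)^{a}.\]
   Context: For an integer $k\ge1$, $F_k:\mathbb{N}\to\mathbb{N}$ is defined by $F_k(0)=0$ and $F_k(n)=n-F_k^k(n-1)$ for $n\ge1$, where $F_k^j$ denotes the $j$-th iterate of $F_k$ ($F_k^0$ is the identity). The sequence $(A_{k,p})_{p\ge0}$ is defined by $A_{k,p}=p+1$ for $0\le p<k$ and $A_{k,p}=A_{k,p-1}+A_{k,p-k}$ for $p\ge k$. $\alpha_k$ is the unique positive real zero of $X^k+X-1$, and $\beta_k=1/\alpha_k$ is the unique positive real zero of $Q_k(X)=X^k-X^{k-1}-1$. $\delta_k(n)=F_k(n)-\alpha_k n$. *)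

theory Defs
  imports Complex_Main "HOL-Library.Extended_Real"
    "HOL-Computational_Algebra.Fundamental_Theorem_Algebra"
begin

text \<open>
  The recursion $F_k(n) = n - F_k^k(n-1)$ is nested, so its termination depends on the bound
  $F_k(m) \le m$. The guard \<open>m \<le> n\<close> makes termination evident; it never takes effect, and
  the lemma \<open>F_rec\<close> below is the recursion without it.
\<close>

fun F :: "nat \<Rightarrow> nat \<Rightarrow> nat" where
  "F k 0 = 0"
| "F k (Suc n) = Suc n - ((\<lambda>m. if m \<le> n then F k m else 0) ^^ k) n"

declare F.simps(2) [simp del]

lemma F_le: "F k n \<le> n"
  by (cases n) (simp_all add: F.simps(2))

lemma F_iter_le: "(F k ^^ j) n \<le> n"
  by (induction j) (auto intro: order_trans[OF F_le])

lemma F_rec: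
  assumes "n \<ge> 1"
  shows "F k n = n - (F k ^^ k) (n - 1)"
proof -
  obtain m where n: "n = Suc m"
    using assms by (cases n) auto
  have "((\<lambda>i. if i \<le> m then F k i else 0) ^^ j) m = (F k ^^ j) m" for j
    by (induction j) (simp_all add: F_iter_le)
  then show ?thesis
    by (simp add: n F.simps(2))
qed

text \<open>The guard \<open>k = 0\<close> only serves termination; the sequence is meant for $k \ge 1$.\<close>

fun A :: "nat \<Rightarrow> nat \<Rightarrow> nat" where
  "A k p = (if k = 0 \<or> p < k then p + 1 else A k (p - 1) + A k (p - k))"

declare A.simps [simp del]

definition alpha :: "nat \<Rightarrow> real" where
  "alpha k = (THE x. x > 0 \<and> x ^ k + x - 1 = 0)"

definition beta :: "nat \<Rightarrow> real" where
  "beta k = 1 / alpha k"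

definition Q :: "nat \<Rightarrow> complex poly" where
  "Q k = monom 1 k - monom 1 (k - 1) - 1"

definition delta :: "nat \<Rightarrow> nat \<Rightarrow> real" where
  "delta k n = real (F k n) - alpha k * real n"

lemma poly_Q: "poly (Q k) z = z ^ k - z ^ (k - 1) - 1"
  by (simp add: Q_def poly_monom)

lemma alpha_ex1:
  assumes "k \<ge> 1"
  shows "\<exists>!x::real. x > 0 \<and> x ^ k + x - 1 = 0"
proof (rule ex_ex1I)
  have "\<exists>x\<ge>0. x \<le> 1 \<and> x ^ k + x - 1 = (0::real)"
    using assms by (intro IVT) (auto intro!: continuous_intros simp: power_0_left)
  then obtain x :: real where x: "x \<ge> 0" "x ^ k + x - 1 = 0"
    by auto
  moreover from x have "x \<noteq> 0"
    using assms by (auto simp: power_0_left)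
  ultimately show "\<exists>x::real. x > 0 \<and> x ^ k + x - 1 = 0"
    by (intro exI[of _ x]) auto
next
  fix x y :: real
  assume x: "x > 0 \<and> x ^ k + x - 1 = 0" and y: "y > 0 \<and> y ^ k + y - 1 = 0"
  have *: False
    if "u < v" "u > 0" "u ^ k + u - 1 = 0" "v ^ k + v - 1 = 0" for u v :: real
    using power_mono[of u v k] that by linarith
  show "x = y"
    using *[of x y] *[of y x] x y by (cases x y rule: linorder_cases) auto
qed

lemma alpha:
  assumes "k \<ge> 1"
  shows "alpha k > 0" "alpha k ^ k + alpha k - 1 = 0"
  using theI'[OF alpha_ex1[OF assms]] unfolding alpha_def by auto

lemma beta_root:
  assumes "k \<ge> 1"
  shows "beta k > 0" "poly (Q k) (of_real (beta k)) = 0"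
proof -
  define a where "a = alpha k"
  have a: "a > 0" "a ^ k + a - 1 = 0"
    using alpha[OF assms] by (simp_all add: a_def)
  then show "beta k > 0"
    by (simp add: beta_def a_def)
  obtain m where k: "k = Suc m"
    using assms by (cases k) auto
  have "(1 / a) ^ k - (1 / a) ^ (k - 1) - 1 = (1 - a - a ^ k) / a ^ k"
    using a(1) by (simp add: k field_simps)
  also have "\<dots> = 0"
    using a(2) by simp
  finally have "beta k ^ k - beta k ^ (k - 1) - 1 = 0"
    by (simp add: beta_def a_def)
  then have "of_real (beta k ^ k - beta k ^ (k - 1) - 1) = (0 :: complex)"
    by (simp only: of_real_0)
  then show "poly (Q k) (of_real (beta k)) = 0"
    by (simp add: poly_Q)
qed

lemma beta_unique:
  assumes "k \<ge> 1" "x > 0" "poly (Q k) (of_real x) = 0"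
  shows "x = beta k"
proof -
  obtain m where k: "k = Suc m"
    using assms by (cases k) auto
  have "of_real (x ^ k - x ^ (k - 1) - 1) = (0 :: complex)"
    using assms(3) by (simp add: poly_Q)
  then have "x ^ k - x ^ (k - 1) - 1 = 0"
    by (simp only: of_real_eq_0_iff)
  moreover have "(1 / x) ^ k + 1 / x - 1 = - (x ^ k - x ^ (k - 1) - 1) / x ^ k"
    using assms(2) by (simp add: k field_simps)
  ultimately have "(1 / x) ^ k + 1 / x - 1 = 0"
    by simp
  then have "1 / x = alpha k"
    using alpha_ex1[OF assms(1)] alpha[OF assms(1)] assms(2)
    by (metis zero_less_divide_1_iff)
  then show ?thesis
    by (simp add: beta_def flip: \<open>1 / x = alpha k\<close>)
qed

definition max_other_zero :: "nat \<Rightarrow> complex \<Rightarrow> bool" where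
  "max_other_zero k r \<longleftrightarrow>
     poly (Q k) r = 0 \<and> r \<noteq> of_real (beta k) \<and>
     (\<forall>z. poly (Q k) z = 0 \<and> z \<noteq> of_real (beta k) \<longrightarrow> cmod z \<le> cmod r)"

text \<open>Zeros as in \<open>max_other_zero\<close> do exist, so quantifying over them is not vacuous.\<close>

lemma max_other_zero_exists:
  assumes "k \<ge> 2"
  shows "\<exists>r. max_other_zero k r"
proof -
  define b where "b = complex_of_real (beta k)"
  define S where "S = {z. poly (Q k) z = 0} - {b}"
  have deg: "degree (Q k) = k"
  proof -
    have "degree (monom (1::complex) (k - 1) + 1) < k"
      using assms by (intro degree_add_less) (auto simp: degree_monom_eq)
    then have "degree (- (monom (1::complex) (k - 1) + 1)) < degree (monom (1::complex) k)"
      by (simp add: degree_monom_eq del: minus_add_distrib)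
    then have "degree (monom 1 k + - (monom (1::complex) (k - 1) + 1)) = k"
      by (subst degree_add_eq_left) (simp_all add: degree_monom_eq)
    then show ?thesis
      by (simp add: Q_def algebra_simps)
  qed
  then have Q0: "Q k \<noteq> 0"
    using assms by auto
  have b: "poly (Q k) b = 0"
    using beta_root[of k] assms by (simp add: b_def)
  then obtain q where q: "Q k = [:- b, 1:] * q"
    by (auto simp: poly_eq_0_iff_dvd)
  have "q \<noteq> 0"
    using Q0 q by auto
  have "degree (Q k) = 1 + degree q"
    using \<open>q \<noteq> 0\<close> by (subst q, subst degree_mult_eq) auto
  then have "degree q \<noteq> 0"
    using deg assms by simp
  then have "\<not> constant (poly q)"
    by (simp add: constant_degree)
  then obtain z where z: "poly q z = 0"
    using fundamental_theorem_of_algebra by blast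
  have "poly (pderiv (Q k)) b \<noteq> 0"
  proof
    assume d: "poly (pderiv (Q k)) b = 0"
    obtain m where m: "k = Suc (Suc m)"
      using assms by (metis add_2_eq_Suc le_Suc_ex)
    have "b \<noteq> 0"
      using beta_root(1)[of k] assms by (simp add: b_def)
    have "of_nat k * b ^ Suc m - of_nat (k - 1) * b ^ m = 0"
      using d by (simp add: Q_def pderiv_diff pderiv_monom poly_monom m)
    then have "b ^ m * (of_nat k * b - of_nat (k - 1)) = 0"
      by (simp add: algebra_simps)
    then have "of_nat k * b - of_nat (k - 1) = 0"
      using \<open>b \<noteq> 0\<close> by simp
    then have "of_real (real k * beta k - real (k - 1)) = (0 :: complex)"
      by (simp add: b_def)
    then have "real k * beta k = real (k - 1)"
      by (simp only: of_real_eq_0_iff)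
    moreover have "beta k > 1"
    proof -
      have "alpha k < 1"
        using alpha[of k] assms zero_less_power[of "alpha k" k] by linarith
      then show ?thesis
        using alpha[of k] assms by (simp add: beta_def)
    qed
    then have "real k * beta k > real k"
      using assms by simp
    ultimately show False
      by linarith
  qed
  moreover have "pderiv (Q k) = q + [:- b, 1:] * pderiv q"
    unfolding q pderiv_mult by (simp add: pderiv_pCons)
  ultimately have "poly q b \<noteq> 0"
    by auto
  then have "z \<in> S"
    using z q by (auto simp: S_def)
  have "finite S"
    using poly_roots_finite[OF Q0] by (simp add: S_def)
  then obtain r where "r \<in> S" "cmod r = Max (cmod ` S)"
    using Max_in[of "cmod ` S"] \<open>z \<in> S\<close> by fastforce
  then show ?thesis
    using \<open>finite S\<close> unfolding max_other_zero_def S_def b_def by (intro exI[of _ r]) auto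
qed

end

theory Submission
  imports Defs "HOL-Complex_Analysis.Complex_Analysis"
begin

text \<open>
  Since $F_k(n + F_k^{k-1}(n)) = n$, the function $F_k$ shifts the sequence $A_{k,p}$ down by one
  index, so the generating function of $\delta_k(A_{k,p})$ is
  $1 + (z - \alpha_k)(1 + z + \dots + z^{k-1}) / (1 - z - z^k)$. The pole at $\alpha_k$ cancels; the
  dominant poles are then the numbers $1/r$, which are simple and not positive real. If
  $\delta_k(A_{k,p}) \le C |r|^p$ for almost all $p$, the series with coefficients
  $C |r|^p - \delta_k(A_{k,p})$ grows at least as fast radially towards $1/|r|$ as towards $1/r$ (up to a
  bounded error), which forces $C \ge |c|$ for the (nonzero) strength $c$ of the pole at $1/r$. The
  same applies to $-\delta_k$. Finally $|r| > 1$ because $y^k + y = 1$ has a non-real solution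
  in the open unit disc, found by the intermediate value theorem.
\<close>

subsection \<open>The action of $F_k$ on the sequence $A_k$\<close>

lemma F_Suc: "F k (Suc n) = Suc n - (F k ^^ k) n"
  by (simp add: F_rec)

lemma F_Suc_add: "F k (Suc n) + (F k ^^ k) n = Suc n"
  using F_iter_le[of k k n] by (simp add: F_Suc)

definition unit_step :: "(nat \<Rightarrow> nat) \<Rightarrow> nat \<Rightarrow> bool" where
  "unit_step f n \<longleftrightarrow> f (Suc n) = f n \<or> f (Suc n) = Suc (f n)"

text \<open>The iterates of \<open>F k\<close> move by 0 or 1 from \<open>m\<close> to
  \<open>n = Suc m\<close>: their values at \<open>m\<close> are at most \<open>m\<close>, where the
  induction hypothesis applies. The recursion turns the step of \<open>F k ^^ k\<close> into the
  complementary step of \<open>F k\<close>.\<close>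

lemma F_step: "unit_step (F k) n"
proof (induction n rule: less_induct)
  case (less n)
  show ?case
  proof (cases n)
    case 0
    have "(F k ^^ k) 0 = 0"
      using F_iter_le[of k k 0] by simp
    then show ?thesis
      using 0 by (simp add: unit_step_def F_Suc)
  next
    case (Suc m)
    have "unit_step (F k ^^ j) m" for j
    proof (induction j)
      case (Suc j)
      then show ?case
        using less[of "(F k ^^ j) m"] F_iter_le[where k = k and j = j and n = m] \<open>n = Suc m\<close>
        by (auto simp: unit_step_def)
    qed (simp add: unit_step_def)
    from this[of k] show ?thesis
      using F_Suc_add[of k n] F_Suc_add[of k m] Suc by (auto simp: unit_step_def)
  qed
qed

text \<open>A flat step of \<open>F k\<close> makes \<open>F k ^^ k\<close> flat as well, and the
  recursion then forces the next step of \<open>F k\<close> to be 1.\<close>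

lemma F_step_twice: "F k (Suc (Suc n)) \<ge> Suc (F k n)" if "k \<ge> 1"
proof (cases n)
  case 0
  have "(F k ^^ k) 0 = 0"
    using F_iter_le[of k k 0] by simp
  then have "F k (Suc 0) = 1" by (simp add: F_Suc)
  then show ?thesis using F_step[of k "Suc 0"] 0 by (auto simp: unit_step_def)
next
  case (Suc m)
  have flat: "(F k ^^ k) (Suc n) = (F k ^^ k) n" if "F k (Suc n) = F k n"
    using that \<open>k \<ge> 1\<close> by (cases k) (simp_all add: funpow_Suc_right del: funpow.simps)
  then show ?thesis
    using F_step[of k n] F_step[of k "Suc n"] F_Suc_add[of k "Suc n"] F_Suc_add[of k n]
    unfolding unit_step_def by fastforce
qed

text \<open>Makes \<open>F k\<close> unbounded, so that the \<open>LEAST\<close> in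
  \<open>F_section\<close> exists.\<close>

lemma F_ge_half:
  assumes "k \<ge> 1"
  shows "F k (2 * n) \<ge> n"
proof (induction n)
  case (Suc n)
  then show ?case
    using F_step_twice[OF assms, of "2 * n"] by simp
qed simp

text \<open>If \<open>m\<close> is the last argument of value \<open>n\<close>, the recursion reads
  \<open>Suc n + (F k ^^ k) m = Suc m\<close>, and
  \<open>(F k ^^ k) m = (F k ^^ (k - 1)) n\<close>.\<close>

lemma F_section:
  assumes "k \<ge> 1"
  shows "F k (n + (F k ^^ (k - 1)) n) = n"
proof -
  \<comment> \<open>the last argument at which \<open>F k\<close> takes the value \<open>n\<close>\<close>
  define m where "m = (LEAST m. F k (Suc m) > n)"
  have "F k (Suc (2 * n + 1)) > n"
    using F_ge_half[OF assms, of "Suc n"] by simp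
  then have gt: "F k (Suc m) > n"
    unfolding m_def by (rule LeastI)
  have le: "F k m \<le> n"
  proof (cases m)
    case (Suc l)
    then have "\<not> F k (Suc l) > n"
      using not_less_Least[of l "\<lambda>m. F k (Suc m) > n"] unfolding m_def by simp
    then show ?thesis using Suc by simp
  qed simp
  have eq: "F k m = n" "F k (Suc m) = Suc n"
    using F_step[of k m] gt le by (auto simp: unit_step_def)
  obtain j where j: "k = Suc j"
    using assms by (cases k) auto
  have "(F k ^^ k) m = (F k ^^ j) (F k m)"
    unfolding j by (simp add: funpow_Suc_right del: funpow.simps)
  then have "m = n + (F k ^^ (k - 1)) n"
    using F_Suc_add[of k m] eq j by simp
  then show ?thesis using eq by simp
qed

lemma A_small: "p < k \<Longrightarrow> A k p = p + 1"
  by (simp add: A.simps)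

lemma A_rec: "k \<ge> 1 \<Longrightarrow> p \<ge> k \<Longrightarrow> A k p = A k (p - 1) + A k (p - k)"
  by (subst A.simps) auto

lemma F_one: "F k 1 = 1"
proof -
  have "(F k ^^ k) 0 = 0"
    using F_iter_le[of k k 0] by simp
  then show ?thesis by (simp add: F_Suc)
qed

text \<open>The recurrence presents \<open>A k p\<close> as \<open>n + (F k ^^ (k - 1)) n\<close>
  with \<open>n = A k (p - 1)\<close>, so \<open>F_section\<close> applies. For \<open>p = 0\<close>
  truncated subtraction leaves the fixed point 1.\<close>

lemma F_A:
  assumes "k \<ge> 1"
  shows "F k (A k p) = A k (p - 1)"
proof (induction p rule: less_induct)
  case (less p)
  show ?case
  proof (cases p)
    case 0
    then show ?thesis
      using A_small[of 0 k] assms F_one by simp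
  next
    case (Suc q)
    have iter: "j \<le> Suc q \<Longrightarrow> (F k ^^ j) (A k q) = A k (q - j)" for j
    proof (induction j)
      case (Suc j)
      then show ?case
        using less[of "q - j"] \<open>p = Suc q\<close> by simp
    qed simp
    have "A k q + (F k ^^ (k - 1)) (A k q) = A k p"
    proof (cases "p \<ge> k")
      case True
      then show ?thesis
        using iter[of "k - 1"] A_rec[OF assms True] Suc assms by simp
    next
      \<comment> \<open>Below \<open>k\<close> the iterates reach the fixed point
        \<open>A k 0 = 1\<close> after \<open>q\<close> steps and stay there.\<close>
      case False
      have one: "(F k ^^ i) 1 = 1" for i
        by (induction i) (simp_all add: F_one del: One_nat_def)
      have "k - 1 = (k - 1 - q) + q" using False Suc by simp
      then have "(F k ^^ (k - 1)) (A k q) = (F k ^^ (k - 1 - q)) ((F k ^^ q) (A k q))"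
        by (metis comp_apply funpow_add)
      also have "\<dots> = 1"
        using iter[of q] one A_small[of 0 k] False Suc by simp
      finally show ?thesis
        using A_small[of q k] A_small[of p k] False Suc by simp
    qed
    then show ?thesis
      using F_section[OF assms, of "A k q"] Suc by simp
  qed
qed

section \<open>Growth of \<open>A k\<close> compared with powers of \<open>beta k\<close>\<close>

lemma A_ge: "k \<ge> 1 \<Longrightarrow> A k p \<ge> p + 1"
proof (induction p rule: less_induct)
  case (less p)
  show ?case
  proof (cases "p < k")
    case False
    then show ?thesis
      using less(1)[of "p - 1"] less(1)[of "p - k"] A_rec[of k p] less.prems by simp
  qed (simp add: A_small)
qed

lemma beta_gt_1: "k \<ge> 1 \<Longrightarrow> beta k > 1"
  using alpha[of k] zero_less_power[of "alpha k" k] unfolding beta_def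
  by (subst less_divide_eq_1_pos) linarith+

lemma beta_power: 
  assumes "k \<ge> 1" "p \<ge> k"
  shows "beta k ^ p = beta k ^ (p - 1) + beta k ^ (p - k)"
proof -
  have "complex_of_real (beta k ^ k - beta k ^ (k - 1) - 1) = 0"
    using beta_root(2)[OF assms(1)] by (simp add: poly_Q)
  then have "beta k ^ k = beta k ^ (k - 1) + 1"
    by (subst (asm) of_real_eq_0_iff) simp
  then have "beta k ^ (p - k) * beta k ^ k = beta k ^ (p - k) * (beta k ^ (k - 1) + 1)"
    by simp
  then show ?thesis
    using assms by (simp add: distrib_left flip: power_add)
qed

text \<open>Both sides obey the same recurrence; the factor \<open>k\<close> covers the initial
  values \<open>p + 1 \<le> k\<close>.\<close>

lemma A_le_beta_power:
  assumes "k \<ge> 1"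
  shows "real (A k p) \<le> k * beta k ^ p"
proof (induction p rule: less_induct)
  case (less p)
  show ?case
  proof (cases "p < k")
    case True
    have "real k * 1 \<le> real k * beta k ^ p"
      using beta_gt_1[OF assms] by (intro mult_left_mono one_le_power) auto
    then show ?thesis
      using True A_small[of p k] by linarith
  next
    case False
    then have "real (A k p) = A k (p - 1) + A k (p - k)"
      using A_rec[of k p] assms by simp
    also have "\<dots> \<le> k * beta k ^ (p - 1) + k * beta k ^ (p - k)"
      using False assms unfolding of_nat_add by (intro add_mono less) auto
    also have "\<dots> = k * beta k ^ p"
      using beta_power[of k p] False assms by (simp add: distrib_left)
    finally show ?thesis .
  qed
qed

subsection \<open>A one-sided Pringsheim-type argument\<close>

text \<open>Otherwise \<open>C - d n\<close> is eventually nonnegative, so its series at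
  \<open>t * w\<close> is bounded by its value at \<open>t\<close> up to a constant. Multiplying by
  \<open>1 - t\<close> and letting \<open>t\<close> tend to 1 gives
  \<open>cmod c \<le> C\<close>.\<close>

lemma coeffs_exceed_infinitely_often:
  fixes d :: "nat \<Rightarrow> real" and f :: "complex \<Rightarrow> complex" and w c :: complex
  assumes sums: "\<And>z. cmod z < 1 \<Longrightarrow> (\<lambda>n. of_real (d n) * z ^ n) sums f z"
    and w: "cmod w = 1"
    and lim1: "((\<lambda>t. of_real (1 - t) * f (of_real t)) \<longlongrightarrow> 0) (at_left 1)"
    and limw: "((\<lambda>t. of_real (1 - t) * f (of_real t * w)) \<longlongrightarrow> c) (at_left 1)"
    and C: "0 \<le> C" "C < cmod c"
  shows "infinite {n. d n > C}"
proof
  assume "finite {n. d n > C}"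
  then obtain N where "{n. d n > C} \<subseteq> {..<N}"
    using finite_nat_bounded by blast
  then have N: "d n \<le> C" if "n \<ge> N" for n
    using that by (auto simp: subset_eq not_less[symmetric])
  define e where "e n = C - d n" for n
  \<comment> \<open>Bounds the cost of replacing each \<open>e n\<close> by its absolute value; only
    indices below \<open>N\<close> contribute.\<close>
  define K where "K = (\<Sum>n<N. \<bar>e n\<bar> - e n)"
  \<comment> \<open>Ensures that \<open>C * (1 - t) / (1 - t * w)\<close> tends to 0.\<close>
  have "w \<noteq> 1"
  proof
    assume "w = 1"
    then have "c = 0"
      using tendsto_unique[OF _ limw] lim1 by simp
    then show False using C by simp
  qed
  have sums_e: "(\<lambda>n. of_real (e n) * z ^ n) sums (of_real C / (1 - z) - f z)"
    if "cmod z < 1" for z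
  proof -
    have "(\<lambda>n. of_real C * z ^ n - of_real (d n) * z ^ n) sums (of_real C * (1 / (1 - z)) - f z)"
      using that by (intro sums_diff sums_mult geometric_sums sums) auto
    then show ?thesis
      by (simp add: e_def algebra_simps)
  qed
  have bound: "cmod (of_real C / (1 - of_real t * w) - f (of_real t * w))
      \<le> Re (of_real C / (1 - of_real t) - f (of_real t)) + K"
    if t: "0 < t" "t < 1" for t :: real
  proof -
    have eRe: "(\<lambda>n. e n * t ^ n) sums Re (of_real C / (1 - of_real t) - f (of_real t))"
      using sums_Re[OF sums_e[of "of_real t"]] t by (simp flip: of_real_power of_real_mult)
    have corr: "(\<lambda>n. if n < N then (\<bar>e n\<bar> - e n) * t ^ n else 0) sums
        (\<Sum>n<N. (\<bar>e n\<bar> - e n) * t ^ n)"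
      using sums_If_finite[of "\<lambda>n. n < N" "\<lambda>n. (\<bar>e n\<bar> - e n) * t ^ n"] by (simp add: lessThan_def)
    have "(\<lambda>n. e n * t ^ n + (if n < N then (\<bar>e n\<bar> - e n) * t ^ n else 0)) = (\<lambda>n. \<bar>e n\<bar> * t ^ n)"
    proof
      fix n
      show "e n * t ^ n + (if n < N then (\<bar>e n\<bar> - e n) * t ^ n else 0) = \<bar>e n\<bar> * t ^ n"
        using N[of n] by (cases "n < N") (simp_all add: e_def left_diff_distrib)
    qed
    then have abs: "(\<lambda>n. \<bar>e n\<bar> * t ^ n) sums (Re (of_real C / (1 - of_real t) - f (of_real t))
        + (\<Sum>n<N. (\<bar>e n\<bar> - e n) * t ^ n))"
      using sums_add[OF eRe corr] by simp
    have "cmod (of_real C / (1 - of_real t * w) - f (of_real t * w))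
        = cmod (\<Sum>n. of_real (e n) * (of_real t * w) ^ n)"
      using sums_e[of "of_real t * w"] t w by (simp add: norm_mult sums_iff)
    also have "\<dots> \<le> (\<Sum>n. \<bar>e n\<bar> * t ^ n)"
      using abs t w by (intro norm_suminf_le) (auto simp: norm_mult norm_power sums_iff power_mult_distrib)
    also have "\<dots> = Re (of_real C / (1 - of_real t) - f (of_real t)) + (\<Sum>n<N. (\<bar>e n\<bar> - e n) * t ^ n)"
      using abs by (simp add: sums_iff)
    also have "(\<Sum>n<N. (\<bar>e n\<bar> - e n) * t ^ n) \<le> K"
      unfolding K_def using t by (intro sum_mono mult_left_le) (auto intro: power_le_one)
    finally show ?thesis by simp
  qed
  \<comment> \<open>This says \<open>cmod c \<le> C\<close>, left in the shape that the limit rules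
    produce.\<close>
  have "cmod (of_real C * 0 / (1 - of_real 1 * w) - c) \<le> C - Re 0 + K * 0"
  proof (rule tendsto_le)
    show "((\<lambda>t. cmod (of_real C * of_real (1 - t) / (1 - of_real t * w)
        - of_real (1 - t) * f (of_real t * w))) \<longlongrightarrow>
      cmod (of_real C * 0 / (1 - of_real 1 * w) - c)) (at_left 1)"
      using \<open>w \<noteq> 1\<close> by (intro tendsto_intros limw) (auto intro!: tendsto_eq_intros)
    show "((\<lambda>t. C - Re (of_real (1 - t) * f (of_real t)) + K * (1 - t)) \<longlongrightarrow> C - Re 0 + K * 0) (at_left 1)"
      by (intro tendsto_intros lim1) (auto intro!: tendsto_eq_intros)
    have "\<forall>\<^sub>F t in at_left 1. t \<in> {0<..<(1::real)}"
      by (rule eventually_at_left_real) simp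
    then show "\<forall>\<^sub>F t in at_left 1. cmod (of_real C * of_real (1 - t) / (1 - of_real t * w)
        - of_real (1 - t) * f (of_real t * w)) \<le> C - Re (of_real (1 - t) * f (of_real t)) + K * (1 - t)"
    proof eventually_elim
      case (elim t)
      have "cmod (of_real C * of_real (1 - t) / (1 - of_real t * w) - of_real (1 - t) * f (of_real t * w))
        = cmod (of_real (1 - t) * (of_real C / (1 - of_real t * w) - f (of_real t * w)))"
        by (simp add: algebra_simps)
      also have "\<dots> = (1 - t) * cmod (of_real C / (1 - of_real t * w) - f (of_real t * w))"
        using elim by (simp only: norm_mult norm_of_real) simp
      also have "\<dots> \<le> (1 - t) * (Re (of_real C / (1 - of_real t) - f (of_real t)) + K)"
        using elim by (intro mult_left_mono bound) auto
      also have "Re (of_real C / (1 - of_real t) - f (of_real t)) = C / (1 - t) - Re (f (of_real t))"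
      proof -
        have "complex_of_real C / (1 - of_real t) = of_real (C / (1 - t))"
          by simp
        then show ?thesis
          by (simp only: minus_complex.simps Re_complex_of_real)
      qed
      also have "(1 - t) * (C / (1 - t) - Re (f (of_real t)) + K)
          = C - Re (of_real (1 - t) * f (of_real t)) + K * (1 - t)"
        using elim by (simp add: field_simps)
      finally show ?case .
    qed
  qed simp
  then show False using C by simp
qed

subsection \<open>The zeros of $Q_k$\<close>

text \<open>Inversion trades the zeros of \<open>Q k\<close> for those of
  \<open>1 - y - y ^ k\<close>, the denominator of the generating function.\<close>

lemma poly_Q_inverse:
  assumes "k \<ge> 1" "y \<noteq> 0"
  shows "poly (Q k) (1 / y) = 0 \<longleftrightarrow> y ^ k + y = 1"
proof -
  obtain m where k: "k = Suc m"
    using assms by (cases k) auto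
  have "poly (Q k) (1 / y) * y ^ k = 1 - y - y ^ k"
    using assms by (simp add: poly_Q k field_simps)
  moreover have "1 - y - y ^ k = 0 \<longleftrightarrow> y ^ k + y = 1"
    by (auto simp: algebra_simps)
  ultimately show ?thesis
    using assms by (metis mult_eq_0_iff power_not_zero)
qed

text \<open>The reciprocal of such a \<open>y\<close> is a non-real zero of \<open>Q k\<close>
  outside the closed unit disc, which forces \<open>cmod r > 1\<close>.\<close>

lemma exists_trinomial_root_in_unit_disc:
  assumes "k \<ge> 6"
  shows "\<exists>y::complex. y ^ k + y = 1 \<and> cmod y < 1 \<and> Im y \<noteq> 0"
proof -
  define n where "n = real k - 1"
  \<comment> \<open>\<open>\<theta>\<^sub>0\<close> solves
    \<open>n * x + (n + 1) * x = 3 * pi\<close>, so that the two angles are symmetric about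
    \<open>3 * pi / 2\<close> and have equal sines; \<open>\<theta>\<^sub>1\<close> solves
    \<open>(n + 1) * x = 2 * pi\<close>.\<close>
  define \<theta>\<^sub>0 where "\<theta>\<^sub>0 = 3 * pi / (2 * n + 1)"
  define \<theta>\<^sub>1 where "\<theta>\<^sub>1 = 2 * pi / (n + 1)"
  have n: "n \<ge> 5" using assms by (simp add: n_def)
  have \<theta>: "0 < \<theta>\<^sub>0" "\<theta>\<^sub>0 < \<theta>\<^sub>1" "\<theta>\<^sub>0 < pi / 3" "\<theta>\<^sub>1 < pi" "n * \<theta>\<^sub>0 > pi"
    using n by (simp_all add: \<theta>\<^sub>0_def \<theta>\<^sub>1_def field_simps)
  have n\<theta>\<^sub>1: "(n + 1) * \<theta>\<^sub>1 = 2 * pi" and n\<theta>\<^sub>0: "(2 * n + 1) * \<theta>\<^sub>0 = 3 * pi"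
    using n by (simp_all add: \<theta>\<^sub>0_def \<theta>\<^sub>1_def)
  \<comment> \<open>Multiplying $y^k + y = 1$ for $y = s e^{ix}$ by $e^{-ikx}$ and by $e^{-ix}$ and taking imaginary
    parts gives \<open>s = s x\<close> and \<open>s ^ k = t x\<close>. At \<open>\<theta>\<^sub>0\<close> we have $s = 1$, at \<open>\<theta>\<^sub>1\<close> we have $s = 0$;
    that $t < 1$ at \<open>\<theta>\<^sub>0\<close> is where $k \ge 6$ is needed.\<close>
  define s where "s x = sin ((n + 1) * x) / sin (n * x)" for x
  define t where "t x = - sin x / sin (n * x)" for x
  have neg: "sin (n * x) < 0" if "\<theta>\<^sub>0 \<le> x" "x \<le> \<theta>\<^sub>1" for x
  proof -
    have "n * x \<ge> n * \<theta>\<^sub>0" "n * x \<le> n * \<theta>\<^sub>1"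
      using that n by (auto intro!: mult_left_mono)
    then have "pi < n * x" "n * x < 2 * pi"
      using \<theta> n\<theta>\<^sub>1 by (auto simp: algebra_simps)
    then show ?thesis by (rule sin_lt_zero)
  qed
  have s0: "s \<theta>\<^sub>0 = 1" and t0: "t \<theta>\<^sub>0 < 1"
  proof -
    have shift: "sin (pi + (pi / 2 - u)) = - cos u" for u :: real
      by (subst sin_periodic_pi2) (simp add: sin_diff)
    have 1: "n * \<theta>\<^sub>0 = pi + (pi / 2 - \<theta>\<^sub>0 / 2)" and 2: "(n + 1) * \<theta>\<^sub>0 = pi + (pi / 2 - (- (\<theta>\<^sub>0 / 2)))"
      using n\<theta>\<^sub>0 by (simp_all add: algebra_simps)
    have 3: "sin (n * \<theta>\<^sub>0) = - cos (\<theta>\<^sub>0 / 2)"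
      unfolding 1 by (rule shift)
    have 4: "sin ((n + 1) * \<theta>\<^sub>0) = - cos (\<theta>\<^sub>0 / 2)"
      unfolding 2 shift by simp
    have pos: "cos (\<theta>\<^sub>0 / 2) > 0"
      using \<theta> by (intro cos_gt_zero) auto
    show "s \<theta>\<^sub>0 = 1"
      using pos by (simp add: s_def 3 4)
    have "sin \<theta>\<^sub>0 = 2 * sin (\<theta>\<^sub>0 / 2) * cos (\<theta>\<^sub>0 / 2)"
      using sin_double[of "\<theta>\<^sub>0 / 2"] by simp
    then have "t \<theta>\<^sub>0 = 2 * sin (\<theta>\<^sub>0 / 2)"
      using pos by (simp add: t_def 3)
    moreover have "sin (\<theta>\<^sub>0 / 2) < sin (pi / 6)"
      using \<theta> by (intro sin_monotone_2pi) auto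
    ultimately show "t \<theta>\<^sub>0 < 1"
      by (simp add: sin_30)
  qed
  have s1: "s \<theta>\<^sub>1 = 0"
    by (simp only: s_def n\<theta>\<^sub>1) simp
  have t1: "t \<theta>\<^sub>1 > 0"
    using neg[of \<theta>\<^sub>1] \<theta> sin_gt_zero[of \<theta>\<^sub>1] by (simp add: t_def divide_pos_neg)
  have cont: "continuous_on {\<theta>\<^sub>0..\<theta>\<^sub>1} (\<lambda>x. s x ^ k - t x)"
    unfolding s_def t_def using neg by (intro continuous_intros ballI less_imp_neq) auto
  have "\<exists>x\<ge>\<theta>\<^sub>0. x \<le> \<theta>\<^sub>1 \<and> s x ^ k - t x = 0"
  proof (intro IVT2' cont)
    show "s \<theta>\<^sub>1 ^ k - t \<theta>\<^sub>1 \<le> 0"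
      using s1 t1 assms by (simp add: power_0_left)
  qed (use s0 t0 \<theta> in auto)
  then obtain x where x: "\<theta>\<^sub>0 \<le> x" "x \<le> \<theta>\<^sub>1" "s x ^ k = t x"
    by auto
  have "x \<noteq> \<theta>\<^sub>0" "x \<noteq> \<theta>\<^sub>1"
    using x s0 t0 s1 t1 assms by (auto simp: power_0_left)
  with x have x': "\<theta>\<^sub>0 < x" "x < \<theta>\<^sub>1" by auto
  have S: "sin (n * x) < 0" using neg x by simp
  \<comment> \<open>Both sines in \<open>s x\<close> are negative. For \<open>s x < 1\<close> their
    difference is written as a product, whose sign is known because
    \<open>(2 * n + 1) * x / 2\<close> lies between \<open>3 * pi / 2\<close> and
    \<open>2 * pi\<close>.\<close>
  have s_nonneg: "s x \<ge> 0" and s_less: "s x < 1"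
  proof -
    have "(n + 1) * x < (n + 1) * \<theta>\<^sub>1" "(2 * n + 1) * \<theta>\<^sub>0 < (2 * n + 1) * x"
      using x' n by (intro mult_strict_left_mono; simp)+
    then have b: "(n + 1) * x < 2 * pi" "(2 * n + 1) * x > 3 * pi"
      unfolding n\<theta>\<^sub>1 n\<theta>\<^sub>0 .
    have "(n + 1) * x > pi"
      using b x' \<theta> by (simp add: algebra_simps)
    then have "sin ((n + 1) * x) < 0"
      using b by (intro sin_lt_zero) auto
    with S show "s x \<ge> 0"
      by (simp add: s_def divide_nonpos_nonpos)
    have half: "(n * x + (n + 1) * x) / 2 = (2 * n + 1) * x / 2"
      "(n * x - (n + 1) * x) / 2 = - (x / 2)"
      by (simp_all add: algebra_simps)
    have "cos (2 * pi - (2 * n + 1) * x / 2) > 0"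
      using b x' \<theta> by (intro cos_gt_zero_pi) (auto simp: algebra_simps)
    then have "cos ((2 * n + 1) * x / 2) > 0"
      by (simp add: cos_diff)
    moreover have "sin (x / 2) > 0"
      using x' \<theta> by (intro sin_gt_zero) auto
    moreover have "sin (n * x) - sin ((n + 1) * x) = 2 * sin (- (x / 2)) * cos ((2 * n + 1) * x / 2)"
      using sin_diff_sin[of "n * x" "(n + 1) * x"] unfolding half by simp
    ultimately have "sin (n * x) - sin ((n + 1) * x) < 0"
      by (simp add: mult_pos_pos)
    then show "s x < 1"
      using S by (simp add: s_def divide_less_eq)
  qed
  define y where "y = rcis (s x) x"
  have kx: "real k * x = n * x + x"
    by (simp add: n_def algebra_simps)
  have yk: "y ^ k = rcis (t x) (n * x + x)"
    unfolding y_def DeMoivre2 kx x(3) by simp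
  have eqs: "s x * sin (n * x) = sin (n * x + x)" "t x * sin (n * x) = - sin x"
    using S by (simp_all add: s_def t_def algebra_simps)
  \<comment> \<open>Multiplying by the nonzero \<open>sin (n * x)\<close> lets \<open>eqs\<close>
    eliminate \<open>s\<close> and \<open>t\<close>; the subtraction formula for sine does the
    rest.\<close>
  have "sin (n * x) * (t x * cos (n * x + x) + s x * cos x) = sin (n * x)"
  proof -
    have "sin (n * x) * (t x * cos (n * x + x) + s x * cos x)
      = (t x * sin (n * x)) * cos (n * x + x) + (s x * sin (n * x)) * cos x"
      by (simp add: algebra_simps)
    also have "\<dots> = sin ((n * x + x) - x)"
      unfolding eqs sin_diff[of "n * x + x" x] by simp
    finally show ?thesis by simp
  qed
  then have re: "t x * cos (n * x + x) + s x * cos x = 1"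
    using S by simp
  have "sin (n * x) * (t x * sin (n * x + x) + s x * sin x) = 0"
  proof -
    have "sin (n * x) * (t x * sin (n * x + x) + s x * sin x)
      = (t x * sin (n * x)) * sin (n * x + x) + (s x * sin (n * x)) * sin x"
      by (simp add: algebra_simps)
    then show ?thesis unfolding eqs by simp
  qed
  then have im: "t x * sin (n * x + x) + s x * sin x = 0"
    using S by simp
  have "y ^ k + y = 1"
    unfolding yk unfolding y_def using re im by (simp add: complex_eq_iff rcis_def)
  moreover have "cmod y < 1"
    using s_nonneg s_less by (simp add: y_def)
  moreover have "Im y \<noteq> 0"
  proof -
    have "s x \<noteq> 0"
      using re im x(3) assms by (auto simp: power_0_left)
    moreover have "sin x > 0"
      using x' \<theta> by (intro sin_gt_zero) auto
    ultimately show ?thesis by (simp add: y_def rcis_def)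
  qed
  ultimately show ?thesis by blast
qed

text \<open>Equality case of the triangle inequality: \<open>cmod y \<le> alpha k\<close> would give
  \<open>1 \<le> cmod y ^ k + cmod y \<le> alpha k ^ k + alpha k = 1\<close>, forcing
  \<open>Re y = cmod y = alpha k\<close>.\<close>

lemma alpha_less_cmod_other_root:
  assumes "k \<ge> 1" "y ^ k + y = 1" "y \<noteq> of_real (alpha k)"
  shows "alpha k < cmod y"
proof (rule ccontr)
  assume "\<not> alpha k < cmod y"
  then have le: "cmod y \<le> alpha k" by simp
  have Re: "Re (y ^ k) + Re y = 1"
    using assms(2) by (metis one_complex.simps(1) plus_complex.simps(1))
  have "cmod y ^ k \<le> alpha k ^ k"
    using le by (intro power_mono) auto
  moreover have "Re (y ^ k) \<le> cmod y ^ k" "Re y \<le> cmod y"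
    using complex_Re_le_cmod[of "y ^ k"] complex_Re_le_cmod[of y] by (auto simp: norm_power)
  ultimately have "Re y = cmod y" "cmod y = alpha k"
    using Re le alpha(2)[OF assms(1)] by linarith+
  then have "y = of_real (alpha k)"
    using cmod_power2[of y] by (simp add: complex_eq_iff)
  with assms(3) show False by simp
qed

text \<open>The lower bound compares \<open>r\<close> with the reciprocal of the root in the disc;
  the upper one inverts \<open>alpha_less_cmod_other_root\<close>. Together they yield
  \<open>0 < a < 1\<close> for the exponent.\<close>

lemma max_other_zero_bounds:
  assumes "k \<ge> 6" "max_other_zero k r"
  shows "1 < cmod r" "cmod r < beta k"
proof -
  have k1: "k \<ge> 1" using assms by simp
  have r: "poly (Q k) r = 0" "r \<noteq> of_real (beta k)"
    and max: "\<And>z. poly (Q k) z = 0 \<Longrightarrow> z \<noteq> of_real (beta k) \<Longrightarrow> cmod z \<le> cmod r"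
    using assms(2) by (auto simp: max_other_zero_def)
  obtain y :: complex where y: "y ^ k + y = 1" "cmod y < 1" "Im y \<noteq> 0"
    using exists_trinomial_root_in_unit_disc[OF assms(1)] by blast
  have "y \<noteq> 0" using y by auto
  moreover have "1 / y \<noteq> of_real (beta k)"
  proof
    assume "1 / y = of_real (beta k)"
    then have "y = of_real (1 / beta k)"
      using \<open>y \<noteq> 0\<close> beta_root(1)[OF k1] by (simp add: field_simps)
    then show False using y(3) by simp
  qed
  ultimately have "1 / cmod y \<le> cmod r"
    using max[of "1 / y"] poly_Q_inverse[OF k1, of y] y by (simp add: norm_divide)
  moreover have "1 < 1 / cmod y"
    using y \<open>y \<noteq> 0\<close> by simp
  ultimately show "1 < cmod r" by linarith
  then have "r \<noteq> 0" by auto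
  then have "(1 / r) ^ k + 1 / r = 1"
    using poly_Q_inverse[OF k1, of "1 / r"] r by simp
  moreover have "1 / r \<noteq> of_real (alpha k)"
    using r \<open>r \<noteq> 0\<close> alpha[OF k1] by (auto simp: beta_def field_simps)
  ultimately have "alpha k < cmod (1 / r)"
    by (intro alpha_less_cmod_other_root k1)
  then show "cmod r < beta k"
    using \<open>r \<noteq> 0\<close> alpha[OF k1] by (simp add: beta_def norm_divide field_simps)
qed

subsection \<open>The generating function of $\delta_k(A_{k,p})$\<close>

text \<open>The recurrence kills the coefficients from index \<open>k\<close> on; below
  \<open>k\<close> the differences of consecutive values \<open>p + 1\<close> leave 1.\<close>

lemma fps_A_mult:
  assumes "k \<ge> 1"
  shows "(1 - fps_X - fps_X ^ k) * Abs_fps (\<lambda>p. complex_of_nat (A k p)) = (\<Sum>i<k. fps_X ^ i)"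
proof (rule fps_ext)
  fix n
  have rhs: "fps_nth (\<Sum>i<k. fps_X ^ i) n = (if n < k then 1 else (0::complex))"
    by (simp add: fps_sum_nth)
  show "fps_nth ((1 - fps_X - fps_X ^ k) * Abs_fps (\<lambda>p. complex_of_nat (A k p))) n
      = fps_nth (\<Sum>i<k. fps_X ^ i) n"
    unfolding rhs using A_rec[OF assms, of n] A_small[of n k] A_small[of "n - 1" k] assms
    by (auto simp: algebra_simps fps_X_power_mult_nth fps_X_power_mult_right_nth)
qed

text \<open>By \<open>F_A\<close> the coefficients are \<open>A k (p - 1) - alpha k * A k p\<close>.
  The summand 1 repairs \<open>p = 0\<close>, where truncated subtraction gives
  \<open>A k 0 = 1\<close> but the shifted series has 0.\<close>

lemma fps_delta_A:
  assumes "k \<ge> 1"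
  shows "Abs_fps (\<lambda>p. complex_of_real (delta k (A k p)))
    = 1 + (fps_X - fps_const (of_real (alpha k))) * Abs_fps (\<lambda>p. of_nat (A k p))"
proof (rule fps_ext)
  fix n
  show "fps_nth (Abs_fps (\<lambda>p. complex_of_real (delta k (A k p)))) n = fps_nth
    (1 + (fps_X - fps_const (of_real (alpha k))) * Abs_fps (\<lambda>p. of_nat (A k p))) n"
    using F_A[OF assms, of n] A_small[of 0 k] assms
    by (cases n) (simp_all add: delta_def left_diff_distrib)
qed

lemma poly_has_fps_expansion:
  fixes p :: "complex poly"
  shows "poly p has_fps_expansion fps_of_poly p"
proof -
  have "poly p = eval_fps (fps_of_poly p)"
    by (rule ext) simp
  then show ?thesis
    using eval_fps_has_fps_expansion[of "fps_of_poly p"] by simp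
qed

text \<open>Rescaling by \<open>R = 1 / cmod r\<close> puts the pole \<open>1 / r\<close> on the
  unit circle, where \<open>coeffs_exceed_infinitely_often\<close> applies to the series and to its
  negative.\<close>

lemma delta_A_infinitely_often:
  assumes k: "k \<ge> 1" and r: "max_other_zero k r" "1 < cmod r" "cmod r < beta k"
  shows "\<exists>c>0. infinite {p. delta k (A k p) > c * cmod r ^ p} \<and>
               infinite {p. - delta k (A k p) > c * cmod r ^ p}"
proof -
  define a where "a = alpha k"
  define w where "w = 1 / r"
  define R where "R = cmod w"
  \<comment> \<open>Denominator of the generating function; \<open>P1\<close> and \<open>P2\<close>
    below split off its zeros \<open>a\<close> and \<open>w\<close> in turn.\<close>
  define P :: "complex poly" where "P = [:1, -1:] - monom 1 k"
  define S :: "complex poly" where "S = (\<Sum>i<k. monom 1 i)"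
  define D where "D = Abs_fps (\<lambda>p. complex_of_real (delta k (A k p)))"
  have a: "a > 0" "a ^ k + a = 1"
    using alpha[OF k] by (auto simp: a_def)
  have w0: "w \<noteq> 0" "r \<noteq> 0" "cmod r > 0"
    using r by (auto simp: w_def)
  then have R: "a < R" "R < 1" "R > 0"
    using r a by (simp_all add: w_def R_def a_def beta_def norm_divide field_simps)
  have poly_P: "poly P z = 1 - z - z ^ k" for z
    by (simp add: P_def poly_monom)
  have P_root: "poly P z = 0 \<longleftrightarrow> z ^ k + z = 1" for z
    unfolding poly_P by (auto simp: algebra_simps)
  have poly_P': "poly (pderiv P) z = - 1 - of_nat k * z ^ (k - 1)" for z
    by (simp add: P_def pderiv_diff pderiv_monom poly_monom pderiv_pCons)
  have "of_real a ^ k + of_real a = (1::complex)"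
    using arg_cong[OF a(2), of complex_of_real] by simp
  then obtain P1 where P1: "P = [:- of_real a, 1:] * P1"
    by (metis P_root poly_eq_0_iff_dvd dvd_def)
  \<comment> \<open>The zero of \<open>P\<close> at \<open>a\<close> is simple, since the derivative
    there is at most -1.\<close>
  have P1_a: "poly P1 (of_real a) \<noteq> 0"
  proof
    assume "poly P1 (of_real a) = 0"
    then have "poly (pderiv P) (of_real a) = 0"
      unfolding P1 pderiv_mult by (simp add: pderiv_pCons)
    then have "complex_of_real (- 1 - real k * a ^ (k - 1)) = 0"
      by (simp add: poly_P')
    then have "- 1 - real k * a ^ (k - 1) = 0"
      by (subst (asm) of_real_eq_0_iff)
    moreover have "real k * a ^ (k - 1) \<ge> 0" using a by simp
    ultimately show False by linarith
  qed
  have "poly P w = 0"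
    using r poly_Q_inverse[OF k w0(1)] w0 by (simp add: P_root max_other_zero_def w_def)
  moreover have "w \<noteq> of_real a"
    using R a by (auto simp: R_def)
  ultimately have "poly P1 w = 0"
    by (simp add: P1)
  then obtain P2 where P2: "P1 = [:- w, 1:] * P2"
    by (metis poly_eq_0_iff_dvd dvd_def)
  \<comment> \<open>A double zero at \<open>w\<close> would give \<open>(k - 1) * w = k\<close>,
    against \<open>cmod w < 1\<close>.\<close>
  have P2_w: "poly P2 w \<noteq> 0"
  proof
    assume "poly P2 w = 0"
    then have "poly (pderiv P) w = 0"
      unfolding P1 P2 pderiv_mult by (simp add: pderiv_pCons)
    moreover have "1 + of_nat k * w ^ (k - 1) = - poly (pderiv P) w"
      by (simp add: poly_P')
    ultimately have "w * (1 + of_nat k * w ^ (k - 1)) = 0"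
      by simp
    then have "w + of_nat k * w ^ k = 0"
      using k by (simp add: power_eq_if algebra_simps split: if_splits)
    moreover have "w ^ k = 1 - w"
      using \<open>poly P w = 0\<close> by (simp add: P_root algebra_simps)
    ultimately have "(of_nat k - 1) * w = of_nat k"
      by (simp add: algebra_simps)
    then have "cmod (of_nat k - 1) * R = k"
      by (metis R_def norm_mult norm_of_nat)
    moreover have "cmod (of_nat k - 1) = real k - 1"
      using k by (metis norm_of_nat of_nat_1 of_nat_diff)
    moreover have "(real k - 1) * R \<le> (real k - 1) * 1"
      using R k by (intro mult_left_mono) auto
    ultimately show False by simp
  qed
  \<comment> \<open>By maximality of \<open>r\<close>, the only possible zero of \<open>P\<close> of
    modulus below \<open>R\<close> is \<open>a\<close>, which \<open>P1_a\<close> excludes for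
    \<open>P1\<close>.\<close>
  have P1_ball: "poly P1 z \<noteq> 0" if "cmod z < R" for z
  proof
    assume z: "poly P1 z = 0"
    have "poly P z = 0" using z by (simp add: P1)
    then have "z \<noteq> 0" using k by (auto simp: poly_P power_0_left)
    have "poly (Q k) (1 / z) = 0"
      using \<open>poly P z = 0\<close> poly_Q_inverse[OF k \<open>z \<noteq> 0\<close>] by (simp add: P_root)
    moreover have "1 / z \<noteq> of_real (beta k)"
    proof
      assume "1 / z = of_real (beta k)"
      then have "z = of_real a"
        using a \<open>z \<noteq> 0\<close> by (simp add: beta_def a_def field_simps)
      then show False using z P1_a by simp
    qed
    ultimately have "cmod (1 / z) \<le> cmod r"
      using r by (auto simp: max_other_zero_def)
    then have "R \<le> cmod z"
      using \<open>z \<noteq> 0\<close> w0 by (simp add: R_def w_def norm_divide field_simps)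
    then show False using that by simp
  qed
  \<comment> \<open>\<open>x ^ k + x\<close> is 1 at \<open>a\<close> and larger at
    \<open>R > a\<close>. So \<open>R\<close> itself is no pole, which later gives
    \<open>lim1\<close>.\<close>
  have P1_R: "poly P1 (of_real R) \<noteq> 0"
  proof
    assume "poly P1 (of_real R) = 0"
    then have "poly P (of_real R) = 0" by (simp add: P1)
    then have "complex_of_real (R ^ k + R) = of_real 1"
      by (simp add: P_root)
    then have "R ^ k + R = 1" by (subst (asm) of_real_eq_iff)
    moreover have "a ^ k \<le> R ^ k" using R a by (intro power_mono) auto
    ultimately show False using R a by linarith
  qed
  define f where "f z = 1 + poly S z / poly P1 z" for z
  have f_exp: "f has_fps_expansion D"
  proof -
    have fps_P: "fps_of_poly P = 1 - fps_X - fps_X ^ k"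
    proof -
      have "[:1, -1:] = 1 - [:0, 1::complex:]" by (simp add: one_pCons)
      then show ?thesis
        by (simp add: P_def fps_of_poly_diff fps_of_poly_monom)
    qed
    have fps_S: "fps_of_poly S = (\<Sum>i<k. fps_X ^ i)"
      by (simp add: S_def fps_of_poly_sum fps_of_poly_monom)
    have fps_lin: "fps_of_poly [:- complex_of_real a, 1:] = fps_X - fps_const (of_real a)"
    proof -
      have "[:- complex_of_real a, 1:] = [:0, 1:] - [:of_real a:]" by simp
      then show ?thesis
        by (simp only: fps_of_poly_diff fps_of_poly_fps_X fps_of_poly_const)
    qed
    have "fps_of_poly P * (D - 1) = fps_of_poly [:- of_real a, 1:] * fps_of_poly S"
      using fps_A_mult[OF k] fps_delta_A[OF k]
      by (simp add: D_def fps_P fps_lin fps_S a_def mult.left_commute)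
    then have "fps_of_poly [:- of_real a, 1:] * (fps_of_poly P1 * (D - 1) - fps_of_poly S) = 0"
      by (simp only: P1 fps_of_poly_mult) (simp add: algebra_simps)
    moreover have "fps_of_poly [:- complex_of_real a, 1:] \<noteq> 0"
      by (metis fps_of_poly_eq_iff fps_of_poly_0 pCons_eq_0_iff zero_neq_one)
    ultimately have "fps_of_poly P1 * (D - 1) = fps_of_poly S"
      by simp
    moreover have P1_0: "fps_nth (fps_of_poly P1) 0 \<noteq> 0"
      using P1_ball[of 0] R by (simp add: poly_0_coeff_0)
    ultimately have "D = 1 + fps_of_poly S / fps_of_poly P1"
      by (metis add.commute diff_add_cancel fps_zero_nth nonzero_mult_div_cancel_left)
    then show ?thesis
      unfolding f_def
      by (auto intro!: has_fps_expansion_add has_fps_expansion_divide' poly_has_fps_expansion P1_0)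
  qed
  have f_holo: "f holomorphic_on ball 0 R"
    unfolding f_def using P1_ball by (auto intro!: holomorphic_intros)
  \<comment> \<open>The expansion \<open>f_exp\<close> is local at 0; holomorphy extends it to the
    whole ball.\<close>
  have sums_f: "(\<lambda>n. of_real (delta k (A k n)) * z ^ n) sums f z" if "cmod z < R" for z
  proof -
    have "fps_conv_radius D \<ge> R"
      using f_exp f_holo by (intro holomorphic_on_imp_fps_conv_radius_ge) auto
    then have "ereal (cmod z) < fps_conv_radius D"
      using that by (metis ereal_less_le less_ereal.simps(1) order_less_le_trans)
    then have "(\<lambda>n. fps_nth D n * z ^ n) sums eval_fps D z"
      by (rule sums_eval_fps)
    also have "eval_fps D z = f z"
      using f_exp that f_holo by (rule has_fps_expansion_imp_eval_fps_eq)
    finally show ?thesis by (simp add: D_def)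
  qed
  define g where "g z = f (of_real R * z)" for z
  define d where "d n = delta k (A k n) * R ^ n" for n
  define w' where "w' = w / of_real R"
  \<comment> \<open>Radial strength of the pole at \<open>w\<close>, read off from
    \<open>P1 = (X - w) * P2\<close>, which at \<open>t * w\<close> gives the factor
    \<open>- (1 - t) * w\<close>.\<close>
  define c where "c = - poly S w / (w * poly P2 w)"
  have sums_g: "(\<lambda>n. of_real (d n) * z ^ n) sums g z" if "cmod z < 1" for z
  proof -
    have "cmod (of_real R * z) < R"
      using that R by (simp add: norm_mult)
    from sums_f[OF this] show ?thesis
      by (simp add: g_def d_def power_mult_distrib mult.assoc)
  qed
  have w': "cmod w' = 1" "of_real R * w' = w"
    using w0 by (auto simp: w'_def R_def norm_divide)
  have lim1: "((\<lambda>t. of_real (1 - t) * g (of_real t)) \<longlongrightarrow> 0) (at_left 1)"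
  proof -
    have "((\<lambda>t. of_real (1 - t) * g (of_real t)) \<longlongrightarrow>
        of_real (1 - 1) * (1 + poly S (of_real R * of_real 1) / poly P1 (of_real R * of_real 1))) (at_left 1)"
      unfolding g_def f_def by (intro tendsto_intros) (use P1_R in auto)
    then show ?thesis by simp
  qed
  have limw: "((\<lambda>t. of_real (1 - t) * g (of_real t * w')) \<longlongrightarrow> c) (at_left 1)"
  proof (rule Lim_transform_eventually)
    have "((\<lambda>t. of_real (1 - t) - poly S (of_real t * w) / (w * poly P2 (of_real t * w))) \<longlongrightarrow>
      of_real (1 - 1) - poly S (of_real 1 * w) / (w * poly P2 (of_real 1 * w))) (at_left 1)"
      by (intro tendsto_intros) (use P2_w w0 in auto)
    then show "((\<lambda>t. of_real (1 - t) - poly S (of_real t * w) / (w * poly P2 (of_real t * w))) \<longlongrightarrow> c) (at_left 1)"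
      by (simp add: c_def)
    have "\<forall>\<^sub>F t in at_left 1. t \<in> {0<..<(1::real)}"
      by (rule eventually_at_left_real) simp
    then show "\<forall>\<^sub>F t in at_left 1. of_real (1 - t) - poly S (of_real t * w) / (w * poly P2 (of_real t * w))
        = of_real (1 - t) * g (of_real t * w')"
    proof eventually_elim
      case (elim t)
      have "of_real R * (of_real t * w') = of_real t * w"
        using w'(2) by (metis mult.left_commute)
      then have "g (of_real t * w') = 1 + poly S (of_real t * w) / poly P1 (of_real t * w)"
        by (simp only: g_def f_def)
      also have "poly P1 (of_real t * w) = - (of_real (1 - t) * (w * poly P2 (of_real t * w)))"
        by (simp add: P2 algebra_simps)
      finally have "of_real (1 - t) * g (of_real t * w') = of_real (1 - t) + of_real (1 - t) *
          (poly S (of_real t * w) / (- (of_real (1 - t) * (w * poly P2 (of_real t * w)))))"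
        by (simp only: distrib_left mult_1_right)
      moreover have "complex_of_real (1 - t) \<noteq> 0"
        using elim by (simp only: of_real_eq_0_iff) simp
      ultimately show ?case
        by (simp del: of_real_diff)
    qed
  qed
  \<comment> \<open>The numerator does not cancel the pole:
    \<open>(w - 1) * poly S w = w ^ k - 1 = - w\<close>.\<close>
  have "c \<noteq> 0"
  proof -
    have "poly S w = (\<Sum>i<k. w ^ i)"
      by (simp add: S_def poly_sum poly_monom)
    then have "(w - 1) * poly S w = w ^ k - 1"
      by (simp add: power_diff_1_eq)
    also have "\<dots> = - w"
      using \<open>poly P w = 0\<close> by (simp add: P_root algebra_simps)
    finally have "poly S w \<noteq> 0" using w0 by auto
    then show ?thesis using P2_w w0 by (simp add: c_def)
  qed
  define C where "C = cmod c / 2"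
  have C: "0 < C" "0 \<le> C" "C < cmod c"
    using \<open>c \<noteq> 0\<close> by (auto simp: C_def)
  have scale: "C < x * R ^ n \<longleftrightarrow> C * cmod r ^ n < x" for x n
    using w0 by (simp add: R_def w_def norm_divide power_one_over field_simps)
  have d_gt: "d n > C \<longleftrightarrow> delta k (A k n) > C * cmod r ^ n"
    "- d n > C \<longleftrightarrow> - delta k (A k n) > C * cmod r ^ n" for n
    using scale[of "delta k (A k n)" n] scale[of "- delta k (A k n)" n] by (simp_all add: d_def)
  have "infinite {n. d n > C}"
    using coeffs_exceed_infinitely_often[OF sums_g w'(1) lim1 limw C(2,3)] by simp
  moreover have "infinite {n. - d n > C}"
  proof (rule coeffs_exceed_infinitely_often[where f = "\<lambda>z. - g z" and w = w' and c = "- c"])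
    show "(\<lambda>n. of_real (- d n) * z ^ n) sums - g z" if "cmod z < 1" for z
      using sums_minus[OF sums_g[OF that]] by simp
  qed (use tendsto_minus[OF lim1] tendsto_minus[OF limw] w' C in auto)
  ultimately show ?thesis
    unfolding d_gt using C(1) by blast
qed

section \<open>The growth exponent, the two index sequences, and unboundedness\<close>

theorem theorem8p2:
  fixes k :: nat
  assumes "k \<ge> 6"
  shows "(SUP n. ereal \<bar>real (F k n) - alpha k * real n\<bar>) = \<infinity>
    \<and> (SUP n. ereal (delta k n)) = \<infinity>
    \<and> (INF n. ereal (delta k n)) = - \<infinity>
    \<and> (\<forall>r a. max_other_zero k r \<and> a = ln (cmod r) / ln (beta k) \<longrightarrow>
         0 < a \<and> a < 1 \<and>
         (\<exists>C > 0. \<exists>v v' :: nat \<Rightarrow> nat. strict_mono v \<and> strict_mono v' \<and>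
            (\<forall>n. delta k (A k (v n)) > C * real (A k (v n)) powr a \<and>
                 delta k (A k (v' n)) < - C * real (A k (v' n)) powr a)))"
proof -
  have k: "k \<ge> 1" using assms by simp
  have growth: "0 < a \<and> a < 1 \<and>
      (\<exists>C > 0. \<exists>v v' :: nat \<Rightarrow> nat. strict_mono v \<and> strict_mono v' \<and>
            (\<forall>n. delta k (A k (v n)) > C * real (A k (v n)) powr a \<and>
                 delta k (A k (v' n)) < - C * real (A k (v' n)) powr a))"
    if r: "max_other_zero k r" and a_def: "a = ln (cmod r) / ln (beta k)" for r a
  proof -
    note bounds = max_other_zero_bounds[OF assms r]
    have beta: "beta k > 1" using beta_gt_1[OF k] .
    have "0 < ln (cmod r)" "ln (cmod r) < ln (beta k)"
      using ln_gt_zero[OF bounds(1)] bounds by (auto intro!: iffD2[OF ln_less_cancel_iff])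
    then have a: "0 < a" "a < 1"
      by (simp_all add: a_def)
    \<comment> \<open>The purpose of the exponent \<open>a\<close>: it turns powers of
      \<open>beta k\<close> into powers of \<open>cmod r\<close>.\<close>
    have beta_powr: "beta k powr a = cmod r"
    proof -
      have "r \<noteq> 0" using bounds by auto
      then show ?thesis using beta by (simp add: a_def powr_def)
    qed
    have A_powr: "real (A k p) powr a \<le> k * cmod r ^ p" for p
    proof -
      have "real (A k p) powr a \<le> (k * beta k ^ p) powr a"
        using A_le_beta_power[OF k] a by (intro powr_mono2) auto
      also have "\<dots> = real k powr a * (beta k powr a) ^ p"
        using beta by (simp add: powr_mult powr_powr mult.commute flip: powr_realpow)
      also have "\<dots> \<le> real k powr 1 * cmod r ^ p"
        unfolding beta_powr using a k by (intro mult_right_mono powr_mono) auto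
      finally show ?thesis by simp
    qed
    obtain c where c: "c > 0" "infinite {p. delta k (A k p) > c * cmod r ^ p}"
        "infinite {p. - delta k (A k p) > c * cmod r ^ p}"
      using delta_A_infinitely_often[OF k r bounds] by blast
    \<comment> \<open>Dividing by \<open>k\<close> absorbs the factor \<open>k\<close> in
      \<open>A_powr\<close>.\<close>
    define C where "C = c / k"
    have C: "C > 0" using c k by (simp add: C_def)
    have below: "C * real (A k p) powr a \<le> c * cmod r ^ p" for p
      using mult_left_mono[OF A_powr[of p], of C] C k by (simp add: C_def)
    obtain v :: "nat \<Rightarrow> nat" where v: "strict_mono v" "\<And>n. delta k (A k (v n)) > c * cmod r ^ v n"
      using infinite_enumerate[OF c(2)] by auto
    obtain v' :: "nat \<Rightarrow> nat" where v': "strict_mono v'" "\<And>n. - delta k (A k (v' n)) > c * cmod r ^ v' n"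
      using infinite_enumerate[OF c(3)] by auto
    have "delta k (A k (v n)) > C * real (A k (v n)) powr a"
      "delta k (A k (v' n)) < - C * real (A k (v' n)) powr a" for n
      using below[of "v n"] v(2)[of n] below[of "v' n"] v'(2)[of n] by auto
    then show ?thesis
      using a C v(1) v'(1) by blast
  qed
  \<comment> \<open>The supremum and infimum claims mention no \<open>r\<close>, so one is supplied
    here.\<close>
  obtain r where r: "max_other_zero k r"
    using max_other_zero_exists[of k] assms by auto
  define a where "a = ln (cmod r) / ln (beta k)"
  obtain C and v v' :: "nat \<Rightarrow> nat" where a: "0 < a" and C: "C > 0"
    and v: "strict_mono v" "\<And>n. delta k (A k (v n)) > C * real (A k (v n)) powr a"
    and v': "strict_mono v'" "\<And>n. delta k (A k (v' n)) < - C * real (A k (v' n)) powr a"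
    using growth[OF r a_def] by blast
  have unbounded: "\<exists>n. B < C * real (A k (u n)) powr a" if u: "strict_mono u" for B and u :: "nat \<Rightarrow> nat"
  proof -
    \<comment> \<open>Chosen so that \<open>C * b = \<bar>B\<bar> + 1\<close> exceeds
      \<open>B\<close>; then \<open>n \<le> u n \<le> A k (u n)\<close> carries the bound
      over.\<close>
    define b where "b = (\<bar>B\<bar> + 1) / C"
    have "b > 0" using C by (simp add: b_def)
    obtain n :: nat where n: "b powr (1 / a) < real n"
      using reals_Archimedean2 by blast
    have "(b powr (1 / a)) powr a < real n powr a"
      using n a by (intro powr_less_mono2) auto
    then have "b < real n powr a"
      using a \<open>b > 0\<close> by (simp add: powr_powr)
    then have n: "B < C * real n powr a"
      using C by (simp add: b_def field_simps)
    have "n \<le> A k (u n)"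
      using seq_suble[OF u, of n] A_ge[OF k, of "u n"] by simp
    then have "C * real n powr a \<le> C * real (A k (u n)) powr a"
      using a C by (intro mult_left_mono powr_mono2) auto
    then show ?thesis using n by (intro exI[of _ n]) simp
  qed
  have up: "\<exists>n. B < delta k n" for B
    using unbounded[OF v(1), of B] v(2) by (meson less_trans)
  have down: "\<exists>n. delta k n < B" for B
  proof -
    obtain n where "- B < C * real (A k (v' n)) powr a"
      using unbounded[OF v'(1)] by blast
    then show ?thesis using v'(2)[of n] by (intro exI[of _ "A k (v' n)"]) simp
  qed
  have "(SUP n. ereal \<bar>real (F k n) - alpha k * real n\<bar>) = \<infinity>"
  proof (rule SUP_PInfty)
    fix n
    obtain m where "real n < delta k m" using up by blast
    then show "\<exists>i\<in>UNIV. ereal (real n) \<le> ereal \<bar>real (F k i) - alpha k * real i\<bar>"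
      by (intro bexI[of _ m]) (auto simp: delta_def)
  qed
  moreover have "(SUP n. ereal (delta k n)) = \<infinity>"
    using up by (intro SUP_PInfty) (auto intro: less_imp_le)
  moreover have "(INF n. ereal (delta k n)) = - \<infinity>"
  proof (rule INF_eqI)
    fix y :: ereal
    assume y: "\<And>i. i \<in> UNIV \<Longrightarrow> y \<le> ereal (delta k i)"
    show "y \<le> - \<infinity>"
    proof (cases y)
      case (real b)
      then show ?thesis using down[of b] y by (auto simp: not_le[symmetric])
    qed (use y in auto)
  qed simp
  ultimately show ?thesis
    using growth by blast
qed

end
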